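(* Let $n$ be a squarefree positive integer such that every prime divisor of $n$ is at least $7$. Suppose $p'$ is a prime divisor of $n$ and $\Omega(n)\neq 2,3$. Then a sequence $T$ in $\mathbb{Z}_n$ is a $D$-extremal sequence for $L(n;p')$ if and only if $T$ is a $D$-extremal sequence for $U(n)$.
   Context: $\mathbb{Z}_n$ denotes the ring $\mathbb{Z}/n\mathbb{Z}$ and $U(n)$ its group of units. For odd $n$ and $x\in U(n)$, $\left(\frac{x}{n}\right)$ denotes the Jacobi symbol. For a prime divisor $p$ of $n$, $L(n;p)=\{a\in U(n):\left(\frac{a}{n}\right)=\left(\frac{a}{p}\right)\}$. For squarefree $n$, $\Omega(n)$ is the number of prime divisors of $n$. For $A\subseteq\mathbb{Z}_n$, a (nonempty, finite) sequence $(y_1,\ldots,y_k)$ in $\mathbb{Z}_n$ is an $A$-weighted zero-sum sequence if there exist $a_1,\ldots,a_k\in A$ with $a_1y_1+\cdots+a_ky_k=0$. The $A$-weighted Davenport constant $D_A(n)$ is the least positive integer $k$ such that every sequence of length $k$ in $\mathbb{Z}_n$ has a (nonempty) subsequence, not necessarily of consecutive terms, that is an $A$-weighted zero-sum sequence. If $0\notin A$, a $D$-extremal sequence for $A$ is a sequence in $\mathbb{Z}_n$ of length $D_A(n)-1$ which has no $A$-weighted zero-sum subsequence. *)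

theory Defs
  imports "HOL-Number_Theory.Number_Theory" "HOL-Computational_Algebra.Squarefree"
    "HOL-Library.Sublist"
begin

text \<open>
  The ring of integers modulo \<open>n\<close> is \<open>residue_ring (int n)\<close>, whose carrier consists of the
  representatives \<open>0, \<dots>, n - 1\<close>. Sequences are lists over this carrier.
\<close>

definition Zmod :: "nat \<Rightarrow> int set" where
  "Zmod n = carrier (residue_ring (int n))"

definition U :: "nat \<Rightarrow> int set" where
  "U n = Units (residue_ring (int n))"

text \<open>Only meaningful for odd \<open>n\<close>; primes are taken with multiplicity.\<close>

definition Jacobi :: "int \<Rightarrow> nat \<Rightarrow> int" where
  "Jacobi a n = (\<Prod>p\<in>#prime_factorization n. Legendre a (int p))"

definition L :: "nat \<Rightarrow> nat \<Rightarrow> int set" where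
  "L n p = {a \<in> U n. Jacobi a n = Jacobi a p}"

definition weighted_zero_sum :: "nat \<Rightarrow> int set \<Rightarrow> int list \<Rightarrow> bool" where
  "weighted_zero_sum n A ys \<longleftrightarrow> ys \<noteq> [] \<and>
     (\<exists>as. length as = length ys \<and> set as \<subseteq> A \<and>
        [(\<Sum>i<length ys. as ! i * ys ! i) = 0] (mod int n))"

definition has_wzs_subseq :: "nat \<Rightarrow> int set \<Rightarrow> int list \<Rightarrow> bool" where
  "has_wzs_subseq n A ys \<longleftrightarrow> (\<exists>zs. subseq zs ys \<and> weighted_zero_sum n A zs)"

text \<open>For \<open>n > 0\<close> and nonempty \<open>A \<subseteq> Zmod n\<close> a suitable \<open>k\<close> exists, for instance \<open>k = n\<close>.\<close>

definition davenport :: "nat \<Rightarrow> int set \<Rightarrow> nat" where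
  "davenport n A = (LEAST k. k > 0 \<and>
     (\<forall>ys. length ys = k \<and> set ys \<subseteq> Zmod n \<longrightarrow> has_wzs_subseq n A ys))"

text \<open>Intended for weight sets \<open>A\<close> with \<open>0 \<notin> A\<close>.\<close>

definition D_extremal :: "nat \<Rightarrow> int set \<Rightarrow> int list \<Rightarrow> bool" where
  "D_extremal n A T \<longleftrightarrow> set T \<subseteq> Zmod n \<and> length T = davenport n A - 1 \<and>
     \<not> has_wzs_subseq n A T"

end

theory Submission
  imports Defs
begin

text \<open>
  Modulo each prime \<open>p\<close> dividing \<open>n\<close>, a subsequence can be cancelled with unit weights iff the
  number of its terms not divisible by \<open>p\<close> (its support at \<open>p\<close>) is not 1. Since \<open>p \<ge> 7\<close>, the
  quadratic characters of these weights can be prescribed freely unless the support is a pair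
  \<open>{j, k}\<close>, in which case the only constraint is the value of the product of the characters at
  \<open>j\<close> and \<open>k\<close>. By the Chinese remainder theorem a \<open>U(n)\<close>-weighted zero-sum subsequence is therefore
  also \<open>L(n;p')\<close>-weighted, unless its supports at all primes other than \<open>p'\<close> are one and the same
  pair. In a sequence with at least four terms, such an exceptional subsequence can be replaced by
  a nonexceptional one. So \<open>U(n)\<close> and \<open>L(n;p')\<close> force zero-sum subsequences in the same sequences of
  length at least 4. For \<open>\<Omega>(n) \<ge> 4\<close> the cofactors \<open>n / p\<close> show that no length up to 4 is forcing,
  hence both Davenport constants agree and exceed 4. For \<open>\<Omega>(n) = 1\<close> the weight sets coincide.
\<close>

subsection \<open>Sums with prescribed quadratic characters\<close>

lemma Legendre_cong:
  assumes "[a = b] (mod m)"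
  shows "Legendre a m = Legendre b m"
  using assms by (simp add: Legendre_def QuadRes_def cong_def)

lemma Legendre_eq_0_iff: "Legendre a m = 0 \<longleftrightarrow> m dvd a"
  by (simp add: Legendre_def cong_0_iff)

lemma Legendre_cases:
  assumes "\<not> m dvd a"
  shows "Legendre a m \<in> {1, -1}"
  using assms by (auto simp: Legendre_def cong_0_iff)

text \<open>Values in \<open>{0, 1, -1}\<close> differ by at most 2, so a modulus above 2 divides
  their difference only if it is 0.\<close>

lemma sign_eq_of_cong:
  fixes a b m :: int
  assumes "[a = b] (mod m)" and "m > 2" and "a \<in> {0, 1, -1}" and "b \<in> {0, 1, -1}"
  shows "a = b"
proof -
  have "m dvd a - b" using assms(1) by (simp add: cong_iff_dvd_diff)
  then show ?thesis
    using assms(2-4) zdvd_imp_le[of m "a - b"] zdvd_imp_le[of m "b - a"]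
    by (fastforce simp: dvd_diff_commute)
qed

section \<open>Quadratic characters modulo an odd prime\<close>

context
  fixes p :: nat
  assumes p: "prime p" and p_odd: "p > 2"
begin

text \<open>By Euler's criterion both sides are congruent to the same power of \<open>a * b\<close>,
  and congruent signs are equal.\<close>

lemma Legendre_mult: "Legendre (a * b) (int p) = Legendre a (int p) * Legendre b (int p)"
proof (rule sign_eq_of_cong)
  have "[Legendre a (int p) * Legendre b (int p) = a ^ ((p - 1) div 2) * b ^ ((p - 1) div 2)] (mod int p)"
    by (intro cong_mult euler_criterion p p_odd)
  moreover have "[Legendre (a * b) (int p) = a ^ ((p - 1) div 2) * b ^ ((p - 1) div 2)] (mod int p)"
    using euler_criterion[OF p p_odd, of "a * b"] by (simp add: power_mult_distrib)
  ultimately show "[Legendre (a * b) (int p) = Legendre a (int p) * Legendre b (int p)] (mod int p)"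
    by (metis cong_sym cong_trans)
qed (use p_odd in \<open>auto simp: Legendre_def\<close>)

lemma Legendre_square:
  assumes "\<not> int p dvd a"
  shows "Legendre (a\<^sup>2) (int p) = 1"
  using Legendre_cases[OF assms] by (auto simp: power2_eq_square Legendre_mult)

lemma Legendre_1: "Legendre 1 (int p) = 1"
  using Legendre_square[of 1] p_odd by simp

text \<open>Squaring on \<open>{0..<p}\<close> is not injective, since 1 and \<open>p - 1\<close>
  have the same square; on a finite set it therefore misses a value.\<close>

lemma nonresidue_exists:
  obtains g where "Legendre g (int p) = -1"
proof -
  let ?R = "{0..<int p}" and ?f = "\<lambda>x. x\<^sup>2 mod int p"
  have "?f 1 = ?f (int p - 1)"
  proof -
    have "(int p - 1)\<^sup>2 = 1 + int p * (int p - 2)"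
      by (simp add: power2_eq_square algebra_simps)
    then show ?thesis by simp
  qed
  then have "\<not> inj_on ?f ?R"
    using p_odd inj_onD[of ?f ?R 1 "int p - 1"] by auto
  then have "?f ` ?R \<noteq> ?R"
    using finite_surj_inj[of ?R ?f] by auto
  moreover have "?f ` ?R \<subseteq> ?R" using p_odd by auto
  ultimately obtain g where g: "g \<in> ?R" "g \<notin> ?f ` ?R" by blast
  have "\<not> QuadRes (int p) g"
  proof
    assume "QuadRes (int p) g"
    then obtain y where "[y\<^sup>2 = g] (mod int p)" by (auto simp: QuadRes_def)
    then have "?f (y mod int p) = g"
      using g(1) by (simp add: cong_def power_mod)
    then have "g \<in> ?f ` ?R" using p_odd by (intro image_eqI[of _ _ "y mod int p"]) auto
    then show False using g(2) by simp
  qed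
  moreover have "g \<noteq> 0" using g(2) p_odd by (auto intro!: image_eqI[of _ _ 0])
  ultimately have "Legendre g (int p) = -1"
    using g(1) by (auto simp: Legendre_def cong_0_iff dest: zdvd_imp_le)
  then show thesis by (rule that)
qed

lemma Legendre_surj:
  assumes "e \<in> {1, -1}"
  obtains x where "Legendre x (int p) = e"
  using assms Legendre_1 nonresidue_exists by blast

lemma not_dvd_of_Legendre:
  assumes "Legendre x (int p) = e" "e \<in> {1, -1}"
  shows "\<not> int p dvd x"
  using assms Legendre_eq_0_iff[of x "int p"] by auto

text \<open>The characters of an element and its inverse multiply to 1, and two signs with product 1
  are equal.\<close>

lemma inverse_exists:
  assumes "\<not> int p dvd a"
  obtains b where "[a * b = 1] (mod int p)" "\<not> int p dvd b" "Legendre b (int p) = Legendre a (int p)"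
proof -
  have "coprime a (int p)"
    using assms p prime_imp_coprime[of "int p" a] by (simp add: coprime_commute)
  then obtain b where b: "[a * b = 1] (mod int p)"
    using cong_solve_coprime_int by blast
  have *: "Legendre a (int p) * Legendre b (int p) = 1"
    using Legendre_cong[OF b] Legendre_1 by (simp add: Legendre_mult)
  then have "\<not> int p dvd b" using Legendre_eq_0_iff[of b "int p"] by auto
  moreover have "Legendre b (int p) = Legendre a (int p)"
    using * Legendre_cases[OF assms] by auto
  ultimately show thesis using b that by blast
qed

text \<open>A representative that is reached by counting up from 1, as the induction in the next
  lemma needs.\<close>

lemma positive_nonresidue_exists:
  shows "\<exists>k. 0 < k \<and> k < int p \<and> Legendre k (int p) = -1"
proof -
  obtain g where g: "Legendre g (int p) = -1" by (rule nonresidue_exists)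
  have "Legendre (g mod int p) (int p) = -1"
    using g Legendre_cong[of "g mod int p" g "int p"] by (simp add: cong_def)
  moreover have "g mod int p \<noteq> 0"
    using g Legendre_eq_0_iff[of g "int p"] by (auto simp: dvd_eq_mod_eq_0)
  moreover have "0 \<le> g mod int p" "g mod int p < int p" using p_odd by simp_all
  ultimately show ?thesis by (intro exI[of _ "g mod int p"]) auto
qed

text \<open>Otherwise the residues would be closed under adding 1 (up to \<open>p - 1\<close>).\<close>
lemma residue_plus_residue_nonresidue:
  "\<exists>x y. Legendre x (int p) = 1 \<and> Legendre y (int p) = 1 \<and> Legendre (x + y) (int p) = -1"
proof (rule ccontr)
  assume neg: "\<not> ?thesis"
  have "Legendre (int k) (int p) = 1" if "0 < k" "k < p" for k
    using that
  proof (induction k)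
    case (Suc k)
    have nd: "\<not> int p dvd int (Suc k)"
      using Suc.prems by (auto dest: zdvd_imp_le)
    show ?case
    proof (cases "k = 0")
      case True then show ?thesis using Legendre_1 by simp
    next
      case False
      then have "Legendre (int k) (int p) = 1" using Suc by simp
      then have "Legendre (int k + 1) (int p) \<noteq> -1" using neg Legendre_1 by blast
      then show ?thesis using Legendre_cases[OF nd] by (simp add: add.commute)
    qed
  qed simp
  moreover obtain k where "0 < k" "k < int p" "Legendre k (int p) = -1"
    using positive_nonresidue_exists by blast
  ultimately show False
    using zero_less_imp_eq_int[of k] by force
qed

end

section \<open>Sign patterns and weights modulo a prime that is at least 7\<close>

context
  fixes p :: nat
  assumes p: "prime p" and p7: "p \<ge> 7"
begin

lemma not_dvd_small: "0 < k \<Longrightarrow> k < 7 \<Longrightarrow> \<not> int p dvd k"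
  using p7 by (auto dest: zdvd_imp_le)

lemma p_odd: "p > 2" using p7 by simp

lemmas Leg_mult = Legendre_mult[OF p p_odd]

lemma Legendre_4: "Legendre 4 (int p) = 1"
  using Legendre_square[OF p p_odd, of 2] not_dvd_small[of 2] by simp

text \<open>Otherwise the residues would be closed under nonzero differences, so would contain
  \<open>3 = 4 - 1\<close>, \<open>2 = 3 - 1\<close>, \<open>-1 = 1 - 2\<close>, hence under nonzero sums.\<close>
lemma residue_minus_residue_nonresidue:
  "\<exists>x y. Legendre x (int p) = 1 \<and> Legendre y (int p) = 1 \<and> Legendre (x - y) (int p) = -1"
proof (rule ccontr)
  assume neg: "\<not> ?thesis"
  have diff: "Legendre (x - y) (int p) = 1"
    if "Legendre x (int p) = 1" "Legendre y (int p) = 1" "\<not> int p dvd x - y" for x y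
    using neg that Legendre_cases by blast
  note one = Legendre_1[OF p p_odd]
  have 3: "Legendre 3 (int p) = 1" using diff[OF Legendre_4 one] not_dvd_small[of 3] by simp
  have 2: "Legendre 2 (int p) = 1" using diff[OF 3 one] not_dvd_small[of 2] by simp
  have "Legendre (-1) (int p) = 1" using diff[OF one 2] not_dvd_small[of 1] by simp
  then have m: "Legendre (- y) (int p) = Legendre y (int p)" for y
    using Leg_mult[of "-1" y] by simp
  obtain x y where "Legendre x (int p) = 1" "Legendre y (int p) = 1" "Legendre (x + y) (int p) = -1"
    using residue_plus_residue_nonresidue[OF p p_odd] by blast
  then show False using neg m[of y] by (metis diff_minus_eq_add)
qed

text \<open>Multiplication by a nonresidue negates all three signs, and exchanging \<open>x\<close>
  and \<open>y\<close> swaps the first two. Up to these symmetries only three of the eight patterns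
  remain.\<close>

lemma ternary_signs:
  assumes "a \<in> {1, -1}" "b \<in> {1, -1}" "c \<in> {1, -1}"
  obtains x y z where "Legendre x (int p) = a" "Legendre y (int p) = b"
    "Legendre z (int p) = c" "z = x + y"
proof -
  let ?P = "\<lambda>a b c. \<exists>x y. Legendre x (int p) = a \<and> Legendre y (int p) = b \<and> Legendre (x + y) (int p) = c"
  obtain g where g: "Legendre g (int p) = -1" by (rule nonresidue_exists[OF p p_odd])
  have neg: "?P (- a) (- b) (- c)" if P: "?P a b c" for a b c
  proof -
    obtain x y where "Legendre x (int p) = a" "Legendre y (int p) = b" "Legendre (x + y) (int p) = c"
      using P by blast
    then show ?thesis
      by (intro exI[of _ "g * x"] exI[of _ "g * y"])
         (simp add: Leg_mult g flip: distrib_left)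
  qed
  have swap: "?P b a c" if "?P a b c" for a b c
    using that by (metis add.commute)
  \<comment> \<open>The witness is 9 + 16 = 25: the squares of 3, 4 and 5, none of which is
    divisible by \<open>p\<close>.\<close>
  have ppp: "?P 1 1 1"
    using Legendre_square[OF p p_odd, of 3] Legendre_square[OF p p_odd, of 4]
      Legendre_square[OF p p_odd, of 5] not_dvd_small[of 3] not_dvd_small[of 4] not_dvd_small[of 5]
    by (intro exI[of _ 9] exI[of _ 16]) simp
  have ppm: "?P 1 1 (-1)" using residue_plus_residue_nonresidue[OF p p_odd] by blast
  \<comment> \<open>A residue \<open>x\<close> is the sum of the residue \<open>y\<close> and the
    nonresidue \<open>x - y\<close>.\<close>
  have pmp: "?P 1 (-1) 1" using residue_minus_residue_nonresidue by (metis add_diff_cancel_left' diff_add_cancel add.commute)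
  have "?P a b c"
    using assms ppp ppm pmp neg[OF ppp] neg[OF ppm] neg[OF pmp] swap[OF pmp] swap[OF neg[OF pmp]]
    by auto
  then show thesis using that by blast
qed

text \<open>Induction adds one term at a time: \<open>ternary_signs\<close> prescribes the character
  of the new term and of the new total, once the old weights are rescaled so that their sum is its
  first summand.\<close>

lemma sum_signs:
  assumes "finite S" and "card S \<ge> 2" and "\<forall>i\<in>S. e i \<in> {1, -1}" and "c \<in> {1, -1}"
  shows "\<exists>w. (\<forall>i\<in>S. Legendre (w i) (int p) = e i) \<and> Legendre (\<Sum>i\<in>S. w i) (int p) = c"
  using assms
proof (induction S arbitrary: c rule: finite_induct)
  case (insert k S)
  \<comment> \<open>The induction hypothesis starts at two elements; for a single element the sum is
    that weight itself.\<close>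
  have "\<exists>v. (\<forall>i\<in>S. Legendre (v i) (int p) = e i) \<and> (\<Sum>i\<in>S. v i) \<noteq> 0
      \<and> Legendre (\<Sum>i\<in>S. v i) (int p) \<in> {1, -1}"
  proof (cases "card S \<ge> 2")
    case True
    then obtain v where "\<forall>i\<in>S. Legendre (v i) (int p) = e i" "Legendre (\<Sum>i\<in>S. v i) (int p) = 1"
      using insert.IH[of 1] insert.prems by auto
    then show ?thesis using Legendre_eq_0_iff[of "\<Sum>i\<in>S. v i" "int p"] by (intro exI[of _ v]) auto
  next
    case False
    then have "card S = 1" using insert by simp
    then obtain j where j: "S = {j}" by (auto simp: card_1_singleton_iff)
    then have ej: "e j \<in> {1, -1}" using insert.prems by simp
    then obtain x where x: "Legendre x (int p) = e j" using Legendre_surj[OF p p_odd] by metis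
    then have "x \<noteq> 0" using ej Legendre_eq_0_iff[of x "int p"] by auto
    then show ?thesis using x j ej by (intro exI[of _ "\<lambda>_. x"]) auto
  qed
  then obtain v where v: "\<forall>i\<in>S. Legendre (v i) (int p) = e i"
      "Legendre (\<Sum>i\<in>S. v i) (int p) \<in> {1, -1}" (is "Legendre ?s _ \<in> _")
    by blast
  obtain x y z where xyz: "Legendre x (int p) = Legendre ?s (int p)" "Legendre y (int p) = e k"
      "Legendre z (int p) = c" "z = x + y"
    using ternary_signs[OF v(2), of "e k" c] insert.prems by blast
  have "\<not> int p dvd ?s" by (rule not_dvd_of_Legendre[OF p p_odd refl v(2)])
  then obtain b where b: "[?s * b = 1] (mod int p)" "Legendre b (int p) = Legendre ?s (int p)"
    using inverse_exists[OF p p_odd] by blast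
  \<comment> \<open>\<open>t\<close> is \<open>x\<close> divided by the old sum. Both have the same
    character, so \<open>t\<close> is a residue and scaling by it changes no sign.\<close>
  define t where "t = x * b"
  have t1: "Legendre t (int p) = 1"
    using b(2) xyz(1) v(2) by (auto simp: t_def Leg_mult)
  have st: "[?s * t = x] (mod int p)"
    using cong_scalar_left[OF b(1), of x] by (simp add: t_def ac_simps)
  define w where "w = (\<lambda>i. if i = k then y else t * v i)"
  have "(\<Sum>i\<in>insert k S. w i) = y + (\<Sum>i\<in>S. w i)" using insert.hyps by (simp add: w_def)
  also have "(\<Sum>i\<in>S. w i) = (\<Sum>i\<in>S. t * v i)"
    using insert.hyps by (intro sum.cong) (auto simp: w_def)
  also have "\<dots> = ?s * t" by (simp add: sum_distrib_left mult.commute)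
  finally have "[(\<Sum>i\<in>insert k S. w i) = z] (mod int p)"
    using cong_add[OF cong_refl[of y] st] xyz(4) by (simp add: add.commute)
  then have "Legendre (\<Sum>i\<in>insert k S. w i) (int p) = c"
    using Legendre_cong xyz(3) by simp
  moreover have "\<forall>i\<in>insert k S. Legendre (w i) (int p) = e i"
    using v(1) xyz(2) t1 insert.hyps by (auto simp: w_def Leg_mult)
  ultimately show ?case by blast
qed simp

text \<open>Leave out one index \<open>k\<close>, give the remaining sum the character for which its
  negative has sign \<open>e k\<close>, and use that negative as the weight at
  \<open>k\<close>.\<close>

lemma zero_sum_signs:
  assumes "finite S" and "card S \<ge> 3" and "\<forall>i\<in>S. e i \<in> {1, -1}"
  shows "\<exists>w. (\<forall>i\<in>S. Legendre (w i) (int p) = e i) \<and> (\<Sum>i\<in>S. w i) = 0"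
proof -
  obtain k where k: "k \<in> S" using assms(2) by fastforce
  have m1: "Legendre (-1) (int p) \<in> {1, -1}"
    using p_odd by (intro Legendre_cases) (auto dest: zdvd_imp_le)
  then have "Legendre (-1) (int p) * e k \<in> {1, -1}" using assms(3) k by auto
  then obtain v where v: "\<forall>i\<in>S - {k}. Legendre (v i) (int p) = e i"
    "Legendre (\<Sum>i\<in>S - {k}. v i) (int p) = Legendre (-1) (int p) * e k"
    using sum_signs[of "S - {k}" e "Legendre (-1) (int p) * e k"] assms k by fastforce
  define s where "s = (\<Sum>i\<in>S - {k}. v i)"
  define w where "w = v(k := - s)"
  have "Legendre (- s) (int p) = e k"
    using Leg_mult[of "-1" s] v(2) m1 by (auto simp: s_def)
  then have "\<forall>i\<in>S. Legendre (w i) (int p) = e i" using v(1) by (auto simp: w_def)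
  moreover have "(\<Sum>i\<in>S. w i) = 0"
    using assms(1) k by (simp add: sum.remove[of S k] w_def s_def)
  ultimately show ?thesis by blast
qed

text \<open>Terms divisible by \<open>p\<close> take any weight. On the support, which is empty or
  has at least three elements, the products \<open>w i * y i\<close> are chosen as a zero sum with
  signs \<open>e i\<close> times the character of \<open>y i\<close>.\<close>

lemma weights_free:
  assumes "finite S" and "\<forall>i\<in>S. e i \<in> {1, -1}"
    and "card {i\<in>S. \<not> int p dvd y i} \<notin> {1, 2}"
  shows "\<exists>w. (\<forall>i\<in>S. Legendre (w i) (int p) = e i) \<and> int p dvd (\<Sum>i\<in>S. w i * y i)"
proof -
  let ?F = "{i\<in>S. \<not> int p dvd y i}"
  have "\<forall>i\<in>S. \<exists>x. Legendre x (int p) = e i"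
    using assms(2) Legendre_surj[OF p p_odd] by metis
  then obtain f where f: "\<forall>i\<in>S. Legendre (f i) (int p) = e i" by metis
  have "\<forall>i\<in>?F. \<exists>b. [y i * b = 1] (mod int p) \<and> Legendre b (int p) = Legendre (y i) (int p)"
    using inverse_exists[OF p p_odd] by blast
  then obtain b where b: "\<forall>i\<in>?F. [y i * b i = 1] (mod int p) \<and> Legendre (b i) (int p) = Legendre (y i) (int p)"
    by metis
  have yF: "\<forall>i\<in>?F. Legendre (y i) (int p) \<in> {1, -1}" using Legendre_cases by blast
  have "\<exists>v. (\<forall>i\<in>?F. Legendre (v i) (int p) = e i * Legendre (y i) (int p)) \<and> (\<Sum>i\<in>?F. v i) = 0"
  proof (cases "?F = {}")
    case True
    show ?thesis unfolding True by simp
  next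
    case False
    then have "card ?F \<noteq> 0" using assms(1) by simp
    then have "card ?F \<ge> 3" using assms(3) by auto
    then show ?thesis
      using zero_sum_signs[of ?F "\<lambda>i. e i * Legendre (y i) (int p)"] assms(1,2) yF by fastforce
  qed
  then obtain v where v: "\<forall>i\<in>?F. Legendre (v i) (int p) = e i * Legendre (y i) (int p)"
    "(\<Sum>i\<in>?F. v i) = 0" by blast
  define w where "w = (\<lambda>i. if i \<in> ?F then v i * b i else f i)"
  have "Legendre (w i) (int p) = e i" if "i \<in> S" for i
  proof (cases "i \<in> ?F")
    case True
    then show ?thesis using v(1) b yF that by (auto simp: w_def Leg_mult)
  next
    case False
    then show ?thesis using f that by (auto simp: w_def)
  qed
  moreover have "[(\<Sum>i\<in>S. w i * y i) = (\<Sum>i\<in>S. if i \<in> ?F then v i else 0)] (mod int p)"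
  proof (rule cong_sum)
    fix i assume i: "i \<in> S"
    show "[w i * y i = (if i \<in> ?F then v i else 0)] (mod int p)"
    proof (cases "i \<in> ?F")
      case True
      then show ?thesis using cong_scalar_left[of "y i * b i" 1 "int p" "v i"] b
        by (simp add: w_def ac_simps)
    qed (use i in \<open>auto simp: cong_0_iff\<close>)
  qed
  moreover have "(\<Sum>i\<in>S. if i \<in> ?F then v i else 0) = (\<Sum>i\<in>?F. v i)"
    using assms(1) by (simp add: sum.If_cases Int_def)
  ultimately show ?thesis using v(2) by (metis cong_0_iff)
qed

text \<open>Cancelling the two surviving terms makes one weight a multiple of the other by
  \<open>- y j / y k\<close>. This fixes the product of their characters as that of
  \<open>- y j * y k\<close>, and nothing else.\<close>

lemma weights_pair:
  assumes "finite S" and "{i\<in>S. \<not> int p dvd y i} = {j, k}" and "j \<noteq> k"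
  shows "\<exists>c\<in>{1, -1}. \<forall>e. (\<forall>i\<in>S. e i \<in> {1, -1}) \<and> e j * e k = c \<longrightarrow>
    (\<exists>w. (\<forall>i\<in>S. Legendre (w i) (int p) = e i) \<and> int p dvd (\<Sum>i\<in>S. w i * y i))"
proof -
  have jk: "\<not> int p dvd y j" "\<not> int p dvd y k" "j \<in> S" "k \<in> S" using assms(2) by blast+
  let ?c = "Legendre (-1) (int p) * Legendre (y j) (int p) * Legendre (y k) (int p)"
  have m1: "Legendre (-1) (int p) \<in> {1, -1}"
    using p_odd by (intro Legendre_cases) (auto dest: zdvd_imp_le)
  have c: "?c \<in> {1, -1}" using Legendre_cases[OF jk(1)] Legendre_cases[OF jk(2)] m1 by auto
  have "\<exists>w. (\<forall>i\<in>S. Legendre (w i) (int p) = e i) \<and> int p dvd (\<Sum>i\<in>S. w i * y i)"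
    if e: "\<forall>i\<in>S. e i \<in> {1, -1}" "e j * e k = ?c" for e
  proof -
    have "\<forall>i\<in>S. \<exists>x. Legendre x (int p) = e i"
      using e(1) Legendre_surj[OF p p_odd] by metis
    then obtain f where f: "\<forall>i\<in>S. Legendre (f i) (int p) = e i" by metis
    obtain b where b: "[y k * b = 1] (mod int p)" "Legendre b (int p) = Legendre (y k) (int p)"
      using inverse_exists[OF p p_odd jk(2)] by blast
    \<comment> \<open>\<open>u\<close> is \<open>- f j * y j / y k\<close> modulo \<open>p\<close>,
      the weight at \<open>k\<close> that cancels the term at \<open>j\<close>.\<close>
    define u where "u = -1 * f j * y j * b"
    have "Legendre u (int p) = e j * ?c"
      unfolding u_def Leg_mult using f jk b(2) by simp
    also have "\<dots> = e j * (e j * e k)" using e(2) by simp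
    also have "\<dots> = e k" using bspec[OF e(1) jk(3)] by auto
    finally have u: "Legendre u (int p) = e k" .
    define w where "w = f(k := u)"
    have "\<forall>i\<in>S. Legendre (w i) (int p) = e i" using f u by (simp add: w_def)
    moreover have "int p dvd (\<Sum>i\<in>S. w i * y i)"
    proof -
      have "(\<Sum>i\<in>S. w i * y i) = (\<Sum>i\<in>S - {j, k}. w i * y i) + (w j * y j + w k * y k)"
        using assms(1,3) jk by (subst sum.subset_diff[of "{j, k}" S]) auto
      moreover have "int p dvd (\<Sum>i\<in>S - {j, k}. w i * y i)"
        using assms(2) by (intro dvd_sum dvd_mult) blast
      moreover have "w j * y j + w k * y k = (f j * y j) * (1 - y k * b)"
        using assms(3) by (simp add: w_def u_def algebra_simps)
      moreover have "int p dvd 1 - y k * b"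
        using b(1) by (simp add: cong_iff_dvd_diff dvd_diff_commute)
      ultimately show ?thesis by (metis dvd_add dvd_mult)
    qed
    ultimately show ?thesis by blast
  qed
  then show ?thesis using c by blast
qed

lemma weights_exist:
  assumes "finite S" and "card {i\<in>S. \<not> int p dvd y i} \<noteq> 1"
  shows "\<exists>w. (\<forall>i\<in>S. \<not> int p dvd w i) \<and> int p dvd (\<Sum>i\<in>S. w i * y i)"
proof -
  have "\<exists>w. (\<forall>i\<in>S. Legendre (w i) (int p) \<in> {1, -1}) \<and> int p dvd (\<Sum>i\<in>S. w i * y i)"
  proof (cases "card {i\<in>S. \<not> int p dvd y i} = 2")
    case True
    then obtain j k where jk: "{i\<in>S. \<not> int p dvd y i} = {j, k}" "j \<noteq> k"
      by (auto simp: card_2_iff)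
    obtain c where c: "c \<in> {1, -1}" "\<forall>e. (\<forall>i\<in>S. e i \<in> {1, -1}) \<and> e j * e k = c \<longrightarrow>
      (\<exists>w. (\<forall>i\<in>S. Legendre (w i) (int p) = e i) \<and> int p dvd (\<Sum>i\<in>S. w i * y i))"
      using weights_pair[OF assms(1) jk] by blast
    have "\<forall>i\<in>S. ((\<lambda>_. 1)(k := c)) i \<in> {1, -1}" using c(1) by simp
    then show ?thesis using jk(2) c(2)[rule_format, of "(\<lambda>_. 1)(k := c)"] by fastforce
  next
    case False
    have "\<forall>i\<in>S. (\<lambda>_. 1) i \<in> {1, -1 :: int}" by simp
    then show ?thesis using weights_free[OF assms(1), of "\<lambda>_. 1" y] assms(2) False by fastforce
  qed
  then show ?thesis using Legendre_eq_0_iff by (metis insert_iff singletonD zero_neq_neg_one zero_neq_one)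
qed

end

subsection \<open>From residues modulo primes to weights modulo \<open>n\<close>\<close>

lemma prod_signs:
  fixes f :: "'a \<Rightarrow> int"
  assumes "\<forall>x\<in>A. f x \<in> {1, -1}"
  shows "prod f A \<in> {1, -1}"
  using assms by (induction A rule: infinite_finite_induct) auto

section \<open>Subsequences as sets of positions\<close>

lemma nths_eq_map_nth: "nths xs N = map ((!) xs) (filter (\<lambda>i. i \<in> N) [0..<length xs])"
proof -
  have "zip xs [0..<length xs] = map (\<lambda>i. (xs ! i, i)) [0..<length xs]"
    by (rule nth_equalityI) auto
  then show ?thesis by (simp add: nths_def filter_map comp_def)
qed

text \<open>With sets of positions in place of subsequences, supports at different primes can be
  compared and enlarged.\<close>

lemma has_wzs_subseq_iff:
  "has_wzs_subseq n A T \<longleftrightarrow> (\<exists>S w. S \<noteq> {} \<and> S \<subseteq> {..<length T} \<and> (\<forall>i\<in>S. w i \<in> A) \<and>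
     int n dvd (\<Sum>i\<in>S. w i * T ! i))" (is "?L \<longleftrightarrow> ?R")
proof
  assume ?L
  then obtain N as where N: "nths T N \<noteq> []" "length as = length (nths T N)" "set as \<subseteq> A"
    and z: "[(\<Sum>i<length (nths T N). as ! i * nths T N ! i) = 0] (mod int n)"
    by (auto simp: has_wzs_subseq_def subseq_conv_nths weighted_zero_sum_def)
  define js where "js = filter (\<lambda>i. i \<in> N) [0..<length T]"
  have js: "nths T N = map ((!) T) js" by (simp add: js_def nths_eq_map_nth)
  \<comment> \<open>\<open>inv_into\<close> gives the rank of a position among the chosen ones,
    which carries list weights over to positions.\<close>
  define w where "w = (\<lambda>i. as ! (inv_into {..<length js} ((!) js) i))"
  have bij: "bij_betw ((!) js) {..<length js} (set js)"
    by (rule bij_betw_nth) (auto simp: js_def)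
  then have inj: "inj_on ((!) js) {..<length js}" by (simp add: bij_betw_def)
  have w: "w (js ! k) = as ! k" if "k < length js" for k
    using inv_into_f_f[OF inj, of k] that by (simp add: w_def)
  have "(\<Sum>i\<in>set js. w i * T ! i) = (\<Sum>k<length js. w (js ! k) * T ! (js ! k))"
    by (rule sum.reindex_bij_betw[OF bij, symmetric])
  also have "\<dots> = (\<Sum>i<length (nths T N). as ! i * nths T N ! i)"
    by (simp add: js w)
  finally have "int n dvd (\<Sum>i\<in>set js. w i * T ! i)" using z by (simp add: cong_0_iff)
  moreover have "\<forall>i\<in>set js. w i \<in> A"
    using w N(2,3) js by (auto simp: in_set_conv_nth) (metis length_map nth_mem subsetD)
  moreover have "set js \<noteq> {}" using N(1) js by simp
  moreover have "set js \<subseteq> {..<length T}" by (auto simp: js_def)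
  ultimately show ?R by blast
next
  assume ?R
  then obtain S w where S: "S \<noteq> {}" "S \<subseteq> {..<length T}" "\<forall>i\<in>S. w i \<in> A"
    "int n dvd (\<Sum>i\<in>S. w i * T ! i)" by blast
  define js where "js = filter (\<lambda>i. i \<in> S) [0..<length T]"
  have js: "nths T S = map ((!) T) js" by (simp add: js_def nths_eq_map_nth)
  have set_js: "set js = S" using S(2) by (auto simp: js_def)
  have bij: "bij_betw ((!) js) {..<length js} S"
    by (rule bij_betw_nth) (use set_js in \<open>simp_all add: js_def\<close>)
  have "(\<Sum>i\<in>S. w i * T ! i) = (\<Sum>k<length js. w (js ! k) * T ! (js ! k))"
    by (rule sum.reindex_bij_betw[OF bij, symmetric])
  also have "\<dots> = (\<Sum>i<length (nths T S). map w js ! i * nths T S ! i)"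
    by (simp add: js)
  finally have "weighted_zero_sum n A (nths T S)"
    using S set_js unfolding weighted_zero_sum_def js
    by (intro conjI exI[of _ "map w js"]) (auto simp: cong_0_iff)
  then show ?L unfolding has_wzs_subseq_def subseq_conv_nths by blast
qed

lemma U_eq:
  assumes "n > 1"
  shows "U n = {x. 0 < x \<and> x < int n \<and> coprime x (int n)}"
proof -
  interpret residues "int n" "residue_ring (int n)"
    using assms by unfold_locales auto
  show ?thesis unfolding U_def by (rule res_units_eq)
qed

lemma Zmod_eq: "Zmod n = {0..int n - 1}"
  by (simp add: Zmod_def residue_ring_def)

section \<open>Chinese remaindering for squarefree moduli\<close>

context
  fixes n :: nat
  assumes n: "n > 1" and sqf: "squarefree n"
begin

lemma prod_prime_factors_eq: "\<Prod>(prime_factors n) = n"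
proof -
  have "(\<Prod>p\<in>prime_factors n. p) = (\<Prod>p\<in>prime_factors n. p ^ multiplicity p n)"
    using sqf n by (intro prod.cong) (simp_all add: squarefree_factorial_semiring')
  then show ?thesis using prod_prime_factors[of n] n by simp
qed

lemma Jacobi_squarefree: "Jacobi a n = (\<Prod>p\<in>prime_factors n. Legendre a (int p))"
proof -
  have "prime_factorization n = mset_set (prime_factors n)"
  proof (rule multiset_eqI)
    fix p
    show "count (prime_factorization n) p = count (mset_set (prime_factors n)) p"
      using sqf n by (cases "p \<in> prime_factors n")
        (simp_all add: squarefree_factorial_semiring' count_prime_factorization in_prime_factors_imp_prime not_in_iff)
  qed
  then show ?thesis unfolding Jacobi_def by (metis prod_unfold_prod_mset)
qed

lemma prime_factors_coprime:
  assumes "p \<in> prime_factors n" "q \<in> prime_factors n" "p \<noteq> q"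
  shows "coprime p q"
  using assms by (intro primes_coprime) auto

lemma dvd_if_prime_factors_dvd:
  assumes "\<forall>p\<in>prime_factors n. int p dvd x"
  shows "int n dvd x"
proof -
  have "[nat \<bar>x\<bar> = 0] (mod (\<Prod>p\<in>prime_factors n. p))"
    using assms by (intro coprime_cong_prod_nat) (auto simp: cong_0_iff intro: prime_factors_coprime)
  then show ?thesis by (simp add: prod_prime_factors_eq cong_0_iff)
qed

text \<open>A prime dividing both \<open>n\<close> and the Chinese remainder solution would divide
  one of the prescribed \<open>u p\<close>.\<close>

lemma crt_unit:
  fixes u :: "nat \<Rightarrow> int"
  assumes "\<forall>p\<in>prime_factors n. \<not> int p dvd u p"
  shows "\<exists>a\<in>U n. \<forall>p\<in>prime_factors n. [a = u p] (mod int p)"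
proof -
  obtain x :: nat where x: "\<forall>p\<in>prime_factors n. [x = nat (u p mod int p)] (mod p)"
    using chinese_remainder_nat[of "prime_factors n" "\<lambda>p. p" "\<lambda>p. nat (u p mod int p)"]
      prime_factors_coprime by (metis finite_set_mset)
  define a where "a = int (x mod n)"
  have cong: "[a = u p] (mod int p)" if p: "p \<in> prime_factors n" for p
  proof -
    have "p > 0" using p by (auto intro: prime_gt_0_nat)
    then have "[int x = u p mod int p] (mod int p)"
      using x p cong_int_iff[of x "nat (u p mod int p)" p] by simp
    moreover have "[a = int x] (mod int p)"
      unfolding a_def using p by (simp add: cong_def zmod_int mod_mod_cancel in_prime_factors_iff)
    ultimately show ?thesis by (simp add: cong_def)
  qed
  have cop: "coprime a (int n)"
  proof (rule ccontr)
    assume "\<not> coprime a (int n)"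
    then have "gcd (x mod n) n \<noteq> 1"
      unfolding a_def coprime_int_iff using coprime_iff_gcd_eq_1 by blast
    then obtain q where "prime q" "q dvd gcd (x mod n) n" using prime_factor_nat by blast
    then have "q \<in> prime_factors n" "int q dvd a"
      using n by (auto simp: in_prime_factors_iff a_def dvd_mod_iff)
    then show False using cong[of q] assms by (simp add: cong_dvd_iff)
  qed
  moreover have "a \<noteq> 0" using cop n by auto
  moreover have "0 \<le> a" "a < int n" using n by (simp_all add: a_def)
  ultimately have "a \<in> U n" by (simp add: U_eq[OF n])
  then show ?thesis using cong by blast
qed

lemma unit_not_dvd:
  assumes "a \<in> U n" "p \<in> prime_factors n"
  shows "\<not> int p dvd a"
proof
  assume "int p dvd a"
  moreover have "int p dvd int n" "prime p" using assms(2) by auto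
  ultimately show False
    using assms(1) coprime_common_divisor[of a "int n" "int p"] not_prime_unit[of "int p"]
    by (auto simp: U_eq[OF n])
qed

text \<open>A lone surviving term modulo \<open>p\<close> would be a product of two factors prime to
  \<open>p\<close>, so it could not vanish.\<close>

lemma U_zero_sum_support:
  assumes "finite S" "\<forall>i\<in>S. w i \<in> U n" "int n dvd (\<Sum>i\<in>S. w i * y i)" "p \<in> prime_factors n"
  shows "card {i\<in>S. \<not> int p dvd y i} \<noteq> 1"
proof
  assume "card {i\<in>S. \<not> int p dvd y i} = 1"
  then obtain k where k: "{i\<in>S. \<not> int p dvd y i} = {k}" by (auto simp: card_1_singleton_iff)
  then have kS: "k \<in> S" "\<not> int p dvd y k" by auto
  have pp: "prime (int p)" and "int p dvd int n" using assms(4) by auto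
  then have "int p dvd (\<Sum>i\<in>S. w i * y i)" using assms(3) dvd_trans by blast
  moreover have "int p dvd (\<Sum>i\<in>S - {k}. w i * y i)" using k by (intro dvd_sum dvd_mult) blast
  ultimately have "int p dvd w k * y k"
    using assms(1) kS by (simp add: sum.remove[of S k] dvd_add_left_iff)
  then show False using pp kS unit_not_dvd[of "w k" p] assms by (auto simp: prime_dvd_mult_iff)
qed

text \<open>The Jacobi symbol of a unit equals its character at \<open>q\<close> exactly when its
  characters at the other primes multiply to 1; weights chosen prime by prime are glued by
  \<open>crt_unit\<close>.\<close>

lemma L_zero_sum:
  assumes "finite S" and q: "q \<in> prime_factors n"
    and "\<forall>p\<in>prime_factors n. (\<forall>i\<in>S. \<not> int p dvd u p i) \<and> int p dvd (\<Sum>i\<in>S. u p i * y i)"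
    and "\<forall>i\<in>S. (\<Prod>p\<in>prime_factors n - {q}. Legendre (u p i) (int p)) = 1"
  shows "\<exists>w. (\<forall>i\<in>S. w i \<in> L n q) \<and> int n dvd (\<Sum>i\<in>S. w i * y i)"
proof -
  have "\<forall>i\<in>S. \<exists>a\<in>U n. \<forall>p\<in>prime_factors n. [a = u p i] (mod int p)"
    using assms(3) by (intro ballI crt_unit) auto
  then obtain w where w: "\<forall>i\<in>S. w i \<in> U n \<and> (\<forall>p\<in>prime_factors n. [w i = u p i] (mod int p))"
    by metis
  have "w i \<in> L n q" if i: "i \<in> S" for i
  proof -
    have "(\<Prod>p\<in>prime_factors n - {q}. Legendre (w i) (int p)) = 1"
    proof -
      have "(\<Prod>p\<in>prime_factors n - {q}. Legendre (w i) (int p)) =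
          (\<Prod>p\<in>prime_factors n - {q}. Legendre (u p i) (int p))"
        using w i by (intro prod.cong Legendre_cong) auto
      then show ?thesis using assms(4) i by simp
    qed
    then have "Jacobi (w i) n = Legendre (w i) (int q)"
      using q by (simp add: Jacobi_squarefree prod.remove[of _ q])
    moreover have "prime q" using q by auto
    ultimately show ?thesis
      using w i by (simp add: L_def Jacobi_def prime_factorization_prime)
  qed
  moreover have "int n dvd (\<Sum>i\<in>S. w i * y i)"
  proof (intro dvd_if_prime_factors_dvd ballI)
    fix p assume p: "p \<in> prime_factors n"
    have "[(\<Sum>i\<in>S. w i * y i) = (\<Sum>i\<in>S. u p i * y i)] (mod int p)"
      using w p by (intro cong_sum cong_scalar_right) blast
    then show "int p dvd (\<Sum>i\<in>S. w i * y i)" using assms(3) p by (simp add: cong_dvd_iff)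
  qed
  ultimately show ?thesis by blast
qed

end

section \<open>Adjusting characters across primes\<close>

context
  fixes n q :: nat
  assumes n: "n > 1" and sqf: "squarefree n" and big: "\<forall>p\<in>prime_factors n. p \<ge> 7"
    and q: "q \<in> prime_factors n"
begin

text \<open>Begin with arbitrary unit weights \<open>v\<close> at every prime and correct their
  characters away from \<open>q\<close>. One prime whose support is not a pair absorbs any sign
  pattern; two primes with different pairs can do so jointly.\<close>

lemma L_zero_sum_of_supports:
  assumes S: "finite S" and ne1: "\<forall>p\<in>prime_factors n. card {i\<in>S. \<not> int p dvd y i} \<noteq> 1"
    and alt: "(\<exists>r\<in>prime_factors n - {q}. card {i\<in>S. \<not> int r dvd y i} \<noteq> 2) \<or>
      (\<exists>r\<in>prime_factors n - {q}. \<exists>s\<in>prime_factors n - {q}.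
         {i\<in>S. \<not> int r dvd y i} \<noteq> {i\<in>S. \<not> int s dvd y i})"
  shows "\<exists>w. (\<forall>i\<in>S. w i \<in> L n q) \<and> int n dvd (\<Sum>i\<in>S. w i * y i)"
proof -
  let ?P = "prime_factors n" and ?F = "\<lambda>p. {i\<in>S. \<not> int p dvd y i}"
  let ?ok = "\<lambda>p w. (\<forall>i\<in>S. \<not> int p dvd w i) \<and> int p dvd (\<Sum>i\<in>S. w i * y i)"
  have pr: "prime p" "p \<ge> 7" "p > 2" if "p \<in> ?P" for p
    using that big by auto
  have "\<forall>p\<in>?P. \<exists>w. ?ok p w"
    using weights_exist[OF pr(1,2) S] ne1 by blast
  then obtain v where v: "\<forall>p\<in>?P. ?ok p (v p)" by metis
  have vsign: "Legendre (v p i) (int p) \<in> {1, -1}" if "p \<in> ?P" "i \<in> S" for p i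
    using v that Legendre_cases by blast
  have okI: "?ok p w"
    if "p \<in> ?P" "\<forall>i\<in>S. Legendre (w i) (int p) = e i" "\<forall>i\<in>S. e i \<in> {1, -1}"
      "int p dvd (\<Sum>i\<in>S. w i * y i)" for p w e
    using that not_dvd_of_Legendre[OF pr(1,3)] by blast
  consider (free) r where "r \<in> ?P - {q}" "card (?F r) \<noteq> 2"
    | (pair) r s where "r \<in> ?P - {q}" "s \<in> ?P - {q}" "?F r \<noteq> ?F s" "card (?F r) = 2" "card (?F s) = 2"
    using alt by blast
  then show ?thesis
  proof cases
    case free
    \<comment> \<open>Taking the signs at \<open>r\<close> equal to \<open>d\<close>, the product of
      the other signs, makes the total product \<open>d i * d i = 1\<close>.\<close>
    define d where "d = (\<lambda>i. \<Prod>p\<in>?P - {q} - {r}. Legendre (v p i) (int p))"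
    have d: "\<forall>i\<in>S. d i \<in> {1, -1}"
      unfolding d_def using vsign by (intro ballI prod_signs) blast
    obtain w where w: "\<forall>i\<in>S. Legendre (w i) (int r) = d i" "int r dvd (\<Sum>i\<in>S. w i * y i)"
      using weights_free[OF pr(1,2) S d, of r y] free ne1 by auto
    have okw: "?ok r w" using okI[OF _ w(1) d w(2)] free by blast
    define u where "u = v(r := w)"
    have "\<forall>p\<in>?P. ?ok p (u p)" using v okw by (simp add: u_def)
    moreover have "(\<Prod>p\<in>?P - {q}. Legendre (u p i) (int p)) = 1" if i: "i \<in> S" for i
    proof -
      have "(\<Prod>p\<in>?P - {q}. Legendre (u p i) (int p)) =
          Legendre (u r i) (int r) * (\<Prod>p\<in>?P - {q} - {r}. Legendre (u p i) (int p))"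
        using free by (intro prod.remove) auto
      also have "(\<Prod>p\<in>?P - {q} - {r}. Legendre (u p i) (int p)) = d i"
        unfolding d_def by (intro prod.cong) (auto simp: u_def)
      finally show ?thesis using w(1) d i by (auto simp: u_def)
    qed
    ultimately show ?thesis using L_zero_sum[OF n sqf S q, of u y] by blast
  next
    case pair
    \<comment> \<open>Between sets of equal size an inclusion would be an equality.\<close>
    have "\<not> ?F r \<subseteq> ?F s" using pair S card_subset_eq[of "?F s" "?F r"] by auto
    then obtain i0 where i0: "i0 \<in> ?F r" "i0 \<notin> ?F s" by blast
    obtain j0 where j0: "?F r = {i0, j0}" "i0 \<noteq> j0"
    proof -
      obtain a b where ab: "?F r = {a, b}" "a \<noteq> b" using pair(4) by (auto simp: card_2_iff)
      then have "i0 = a \<or> i0 = b" using i0(1) by blast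
      then show thesis using that[of a] that[of b] ab by (metis insert_commute)
    qed
    obtain k l where kl: "?F s = {k, l}" "k \<noteq> l" using pair(5) by (auto simp: card_2_iff)
    have i0': "i0 \<noteq> k" "i0 \<noteq> l" using i0(2) kl by auto
    have inS: "i0 \<in> S" "j0 \<in> S" using j0 by blast+
    obtain c where c: "c \<in> {1, -1}" and c': "\<forall>e. (\<forall>i\<in>S. e i \<in> {1, -1}) \<and> e i0 * e j0 = c \<longrightarrow>
        (\<exists>w. (\<forall>i\<in>S. Legendre (w i) (int r) = e i) \<and> int r dvd (\<Sum>i\<in>S. w i * y i))"
      using weights_pair[OF pr(1,2) S j0] pair by blast
    obtain b where b: "b \<in> {1, -1}" and b': "\<forall>e. (\<forall>i\<in>S. e i \<in> {1, -1}) \<and> e k * e l = b \<longrightarrow>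
        (\<exists>w. (\<forall>i\<in>S. Legendre (w i) (int s) = e i) \<and> int s dvd (\<Sum>i\<in>S. w i * y i))"
      using weights_pair[OF pr(1,2) S kl] pair by blast
    \<comment> \<open>The signs will be \<open>e\<close> at \<open>s\<close> and
      \<open>d * e\<close> at \<open>r\<close>, so that the total product is 1 for every
      \<open>e\<close>. It remains to satisfy \<open>e k * e l = b\<close> and
      \<open>(d i0 * e i0) * (d j0 * e j0) = c\<close>.\<close>
    define d where "d = (\<lambda>i. \<Prod>p\<in>?P - {q} - {r} - {s}. Legendre (v p i) (int p))"
    have d: "\<forall>i\<in>S. d i \<in> {1, -1}"
      unfolding d_def using vsign by (intro ballI prod_signs) blast
    define e0 :: "'a \<Rightarrow> int" where "e0 = (\<lambda>_. 1)(l := b)"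
    \<comment> \<open>As \<open>i0\<close> lies outside the support at \<open>s\<close>, the sign there is free to meet the constraint at \<open>r\<close>.\<close>
    define e where "e = e0(i0 := c * d i0 * d j0 * e0 j0)"
    have dd: "d i0 \<in> {1, -1}" "d j0 \<in> {1, -1}" using d inS by blast+
    have e0: "e0 i \<in> {1, -1}" for i using b by (simp add: e0_def)
    have e1: "c * d i0 * d j0 * e0 j0 \<in> {1, -1}" using c dd e0[of j0] by auto
    have e: "\<forall>i\<in>S. e i \<in> {1, -1}" using e0 e1 by (simp add: e_def)
    have "e k * e l = b" using i0' kl(2) by (simp add: e_def e0_def)
    then obtain ws where ws: "\<forall>i\<in>S. Legendre (ws i) (int s) = e i" "int s dvd (\<Sum>i\<in>S. ws i * y i)"
      using b' e by blast
    have de: "\<forall>i\<in>S. d i * e i \<in> {1, -1}" using d e by fastforce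
    have "(d i0 * e i0) * (d j0 * e j0) = c"
      using dd e0[of j0] j0(2) by (auto simp: e_def)
    then obtain wr where wr: "\<forall>i\<in>S. Legendre (wr i) (int r) = d i * e i" "int r dvd (\<Sum>i\<in>S. wr i * y i)"
      using c'[rule_format, of "\<lambda>i. d i * e i"] de by blast
    have rs: "r \<noteq> s" using pair by blast
    define u where "u = v(r := wr, s := ws)"
    have "?ok r wr" using okI[OF _ wr(1) de wr(2)] pair by blast
    moreover have "?ok s ws" using okI[OF _ ws(1) e ws(2)] pair by blast
    ultimately have "\<forall>p\<in>?P. ?ok p (u p)" using v by (simp add: u_def)
    moreover have "(\<Prod>p\<in>?P - {q}. Legendre (u p i) (int p)) = 1" if i: "i \<in> S" for i
    proof -
      have "(\<Prod>p\<in>?P - {q}. Legendre (u p i) (int p)) =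
          Legendre (u r i) (int r) * (\<Prod>p\<in>?P - {q} - {r}. Legendre (u p i) (int p))"
        using pair by (intro prod.remove) auto
      also have "(\<Prod>p\<in>?P - {q} - {r}. Legendre (u p i) (int p)) =
          Legendre (u s i) (int s) * (\<Prod>p\<in>?P - {q} - {r} - {s}. Legendre (u p i) (int p))"
        using pair rs by (intro prod.remove) auto
      also have "(\<Prod>p\<in>?P - {q} - {r} - {s}. Legendre (u p i) (int p)) = d i"
        unfolding d_def by (intro prod.cong) (auto simp: u_def)
      finally have "(\<Prod>p\<in>?P - {q}. Legendre (u p i) (int p)) = (d i * e i) * (e i * d i)"
        using wr(1) ws(1) i rs by (simp add: u_def)
      then show ?thesis using bspec[OF d i] bspec[OF e i] by auto
    qed
    ultimately show ?thesis using L_zero_sum[OF n sqf S q, of u y] by blast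
  qed
qed

end

subsection \<open>Exceptional supports\<close>

text \<open>Enlarging an exceptional set by an index of another support breaks the common pair. This
  is blocked only if it creates a singleton support at \<open>q\<close>, and then adding two indices
  at once succeeds.\<close>

lemma supports_alternative:
  fixes F :: "'b \<Rightarrow> 'a set"
  assumes I: "finite I" "card I \<ge> 4" and q: "q \<in> P" and M: "P - {q} \<noteq> {}"
    and S: "S \<subseteq> I" "S \<noteq> {}" and ne1: "\<forall>p\<in>P. card (F p \<inter> S) \<noteq> 1"
  shows "\<exists>S'. S' \<subseteq> I \<and> S' \<noteq> {} \<and> (\<forall>p\<in>P. card (F p \<inter> S') \<noteq> 1) \<and>
    ((\<exists>r\<in>P - {q}. card (F r \<inter> S') \<noteq> 2) \<or> (\<exists>r\<in>P - {q}. \<exists>s\<in>P - {q}. F r \<inter> S' \<noteq> F s \<inter> S'))"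
proof (rule ccontr)
  assume neg: "\<not> ?thesis"
  \<comment> \<open>Call a nonempty set without singleton supports admissible. By
    \<open>neg\<close>, its supports away from \<open>q\<close> are all the same pair.\<close>
  have H: "card (F r \<inter> S') = 2 \<and> F r \<inter> S' = F s \<inter> S'"
    if "S' \<subseteq> I" "S' \<noteq> {}" "\<forall>p\<in>P. card (F p \<inter> S') \<noteq> 1" "r \<in> P - {q}" "s \<in> P - {q}" for S' r s
  proof -
    have "\<not> ((\<exists>r\<in>P - {q}. card (F r \<inter> S') \<noteq> 2) \<or>
        (\<exists>r\<in>P - {q}. \<exists>s\<in>P - {q}. F r \<inter> S' \<noteq> F s \<inter> S'))"
      using neg that(1-3) by metis
    then show ?thesis using that(4,5) by blast
  qed
  obtain m where m: "m \<in> P - {q}" using M by blast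
  have finS: "finite S" using S(1) I(1) by (rule finite_subset)
  define A where "A = F m \<inter> S"
  have A: "card A = 2" "\<And>r. r \<in> P - {q} \<Longrightarrow> F r \<inter> S = A"
    unfolding A_def using H[OF S ne1 m m] H[OF S ne1 _ m] by blast+
  define Z where "Z = {i\<in>I. \<forall>r\<in>P - {q}. i \<notin> F r}"
  \<comment> \<open>Otherwise \<open>{i}\<close> would be admissible with all supports
    empty.\<close>
  have Zq: "i \<in> F q" if i: "i \<in> Z" for i
  proof (rule ccontr)
    assume "i \<notin> F q"
    then have "F p \<inter> {i} = {}" if "p \<in> P" for p using i that by (auto simp: Z_def)
    then show False using H[of "{i}" m m] m i by (auto simp: Z_def)
  qed
  \<comment> \<open>Otherwise \<open>{i, j}\<close> would be admissible, with full support at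
    \<open>q\<close> and empty supports elsewhere.\<close>
  have Z1: "i = j" if ij: "i \<in> Z" "j \<in> Z" for i j
  proof (rule ccontr)
    assume "i \<noteq> j"
    moreover have "F p \<inter> {i, j} = (if p = q then {i, j} else {})" if "p \<in> P" for p
      using ij that Zq by (auto simp: Z_def)
    ultimately have "\<forall>p\<in>P. card (F p \<inter> {i, j}) \<noteq> 1" "F m \<inter> {i, j} = {}" using m by auto
    then show False using H[of "{i, j}" m m] m ij by (simp add: Z_def)
  qed
  have SA: "S - A \<subseteq> Z" using S(1) A(2) by (auto simp: Z_def)
  have "card Z \<le> 1" using Z1 by (intro card_le_Suc0_iff_eq[THEN iffD2, unfolded One_nat_def[symmetric]])
      (use I(1) in \<open>auto simp: Z_def\<close>)
  \<comment> \<open>At most three indices are covered, so a fourth lies outside both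
    \<open>A\<close> and \<open>Z\<close>, hence in \<open>F s\<close> for some \<open>s\<close>
    other than \<open>q\<close>.\<close>
  then have "card (A \<union> Z) \<le> 3" using A(1) card_Un_le[of A Z] by linarith
  then have "\<not> I \<subseteq> A \<union> Z"
    using I(2) card_mono[of "A \<union> Z" I] finS I(1) by (auto simp: A_def Z_def)
  then obtain r where r: "r \<in> I" "r \<notin> A" "r \<notin> Z" by blast
  have rS: "r \<notin> S" using r SA by blast
  \<comment> \<open>Adding \<open>i\<close> gives some \<open>F s\<close> a third element, so
    \<open>insert i S\<close> cannot be admissible. The only possible obstruction is the new
    singleton support \<open>{i}\<close> at \<open>q\<close>.\<close>
  have extend: "F q \<inter> S = {} \<and> i \<in> F q" if i: "i \<in> I" "i \<notin> Z" "i \<notin> S" for i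
  proof (rule ccontr)
    assume neg: "\<not> ?thesis"
    obtain s where s: "s \<in> P - {q}" "i \<in> F s" using i by (auto simp: Z_def)
    have "card (F p \<inter> insert i S) \<noteq> 1" if p: "p \<in> P" for p
    proof (cases "i \<in> F p")
      case True
      then have "card (F p \<inter> insert i S) = Suc (card (F p \<inter> S))" using i finS by simp
      moreover have "F p \<inter> S \<noteq> {}"
        using True p neg A by (cases "p = q") auto
      ultimately show ?thesis using finS by simp
    qed (use ne1 p in simp)
    then have "card (F s \<inter> insert i S) = 2" using H[of "insert i S" s s] s S(1) i by auto
    moreover have "finite A" "i \<notin> A" using finS i by (auto simp: A_def)
    then have "card (F s \<inter> insert i S) = 3" using s A by simp
    ultimately show False by simp
  qed
  have q0: "F q \<inter> S = {}" "r \<in> F q" using extend[of r] r rS by auto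
  \<comment> \<open>An element of \<open>S - A\<close> would lie in \<open>Z\<close>, hence in
    \<open>F q\<close>, which misses \<open>S\<close>.\<close>
  then have SA': "S = A" using SA Zq A_def by blast
  have "\<not> I \<subseteq> insert r A"
    using I(2) card_mono[of "insert r A" I] A(1) card_insert_le_m1[of 3 A r] finS by (auto simp: A_def)
  then obtain i where i: "i \<in> I" "i \<noteq> r" "i \<notin> S" using SA' by blast
  have iq: "i \<in> F q" using Zq extend[of i] i by blast
  let ?S = "insert i (insert r S)"
  have "card (F p \<inter> ?S) \<noteq> 1" if p: "p \<in> P" for p
  proof (cases "p = q")
    case True
    have "F q \<inter> ?S = {i, r}" using q0 iq by blast
    then show ?thesis using True i by simp
  next
    case False
    then have "A \<subseteq> F p \<inter> ?S" using A(2)[of p] p by blast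
    then have "card A \<le> card (F p \<inter> ?S)" using finS by (intro card_mono) auto
    then show ?thesis using A(1) by simp
  qed
  moreover obtain s where s: "s \<in> P - {q}" "r \<in> F s" using r by (auto simp: Z_def)
  ultimately have "card (F s \<inter> ?S) = 2" using H[of ?S s s] S(1) r i by auto
  moreover have "card (insert r A) \<le> card (F s \<inter> ?S)"
    using finS s A(2)[OF s(1)] by (intro card_mono) auto
  moreover have "card (insert r A) = 3" using A(1) r(2) finS by (simp add: A_def)
  ultimately show False by simp
qed

lemma has_wzs_subseq_mono:
  assumes "A \<subseteq> B" "has_wzs_subseq n A T"
  shows "has_wzs_subseq n B T"
  using assms unfolding has_wzs_subseq_iff by (meson subsetD)

lemma L_subset_U: "L n q \<subseteq> U n"
  by (auto simp: L_def)

section \<open>Comparison of the two Davenport constants\<close>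

context
  fixes n q :: nat
  assumes n: "n > 1" and sqf: "squarefree n" and big: "\<forall>p\<in>prime_factors n. p \<ge> 7"
    and q: "q \<in> prime_factors n" and k: "card (prime_factors n) \<ge> 4"
begin

text \<open>Unit weights exclude singleton supports; four positions suffice to pass to a
  nonexceptional index set, which admits weights in \<open>L n q\<close>.\<close>

lemma has_wzs_subseq_L_iff_U:
  assumes "length T \<ge> 4"
  shows "has_wzs_subseq n (L n q) T \<longleftrightarrow> has_wzs_subseq n (U n) T"
proof
  assume "has_wzs_subseq n (U n) T"
  then obtain S w where S: "S \<noteq> {}" "S \<subseteq> {..<length T}" "\<forall>i\<in>S. w i \<in> U n"
    "int n dvd (\<Sum>i\<in>S. w i * T ! i)"
    unfolding has_wzs_subseq_iff by blast
  have finS: "finite S" using S(2) finite_subset by blast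
  define F where "F = (\<lambda>p. {i. \<not> int p dvd T ! i})"
  have F: "F p \<inter> S = {i\<in>S. \<not> int p dvd T ! i}" for p S by (auto simp: F_def)
  have ne1: "\<forall>p\<in>prime_factors n. card (F p \<inter> S) \<noteq> 1"
    unfolding F using U_zero_sum_support[OF n sqf finS S(3,4)] by blast
  have "card (prime_factors n - {q}) \<noteq> 0" using k q by simp
  then have M: "prime_factors n - {q} \<noteq> {}" by fastforce
  have "card {..<length T} \<ge> 4" using assms by simp
  note alt = supports_alternative[OF finite_lessThan this q M S(2,1) ne1, unfolded F]
  obtain S' where S': "S' \<subseteq> {..<length T}" "S' \<noteq> {}"
    "\<forall>p\<in>prime_factors n. card {i\<in>S'. \<not> int p dvd T ! i} \<noteq> 1"
    "(\<exists>r\<in>prime_factors n - {q}. card {i\<in>S'. \<not> int r dvd T ! i} \<noteq> 2) \<or>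
      (\<exists>r\<in>prime_factors n - {q}. \<exists>s\<in>prime_factors n - {q}.
         {i\<in>S'. \<not> int r dvd T ! i} \<noteq> {i\<in>S'. \<not> int s dvd T ! i})"
    using alt by (elim exE conjE) (rule that)
  then show "has_wzs_subseq n (L n q) T"
    using L_zero_sum_of_supports[OF n sqf big q finite_subset[OF S'(1) finite_lessThan] S'(3,4)] S'(1,2)
    unfolding has_wzs_subseq_iff by blast
qed (rule has_wzs_subseq_mono[OF L_subset_U])

text \<open>The cofactors \<open>n / p\<close> are nonzero modulo \<open>p\<close> only, so none of them can be cancelled.\<close>
lemma U_free_sequence:
  assumes "j \<le> 4"
  shows "\<exists>T. length T = j \<and> set T \<subseteq> Zmod n \<and> \<not> has_wzs_subseq n (U n) T"
proof -
  obtain Q where Q: "Q \<subseteq> prime_factors n" "card Q = j"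
    using obtain_subset_with_card_n[of j "prime_factors n"] k assms by (metis order_trans)
  have "finite Q" using Q(1) finite_subset by blast
  then obtain ps where ps: "set ps = Q" "distinct ps" using finite_distinct_list by blast
  have len: "length ps = j" using ps Q(2) distinct_card by metis
  let ?T = "map (\<lambda>p. int (n div p)) ps"
  have pr: "prime p" "p dvd n" if "p \<in> Q" for p using that Q(1) by auto
  have nd: "int p dvd int (n div r) \<longleftrightarrow> p \<noteq> r" if pr': "p \<in> Q" "r \<in> Q" for p r
  proof (cases "p = r")
    case True
    obtain c where c: "n = p * c" using pr(2)[OF pr'(1)] by blast
    have "\<not> p dvd n div p"
    proof
      assume "p dvd n div p"
      then have "p\<^sup>2 dvd n" using c pr(1)[OF pr'(1)] by (auto simp: power2_eq_square prime_gt_0_nat)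
      then have "is_unit p" using sqf by (rule squarefreeD[rotated])
      then show False using pr(1)[OF pr'(1)] by simp
    qed
    then show ?thesis using True by simp
  next
    case False
    have "p dvd r * (n div r)" using pr[OF pr'(1)] pr(2)[OF pr'(2)] by simp
    moreover have "\<not> p dvd r" using False pr(1) pr' primes_dvd_imp_eq by blast
    ultimately have "p dvd n div r" using pr(1)[OF pr'(1)] prime_dvd_mult_nat by blast
    then show ?thesis using False by simp
  qed
  have "\<not> has_wzs_subseq n (U n) ?T"
  proof
    assume "has_wzs_subseq n (U n) ?T"
    then obtain S w where S: "S \<noteq> {}" "S \<subseteq> {..<length ps}" "\<forall>i\<in>S. w i \<in> U n"
      "int n dvd (\<Sum>i\<in>S. w i * ?T ! i)"
      unfolding has_wzs_subseq_iff by auto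
    then obtain i where i: "i \<in> S" by blast
    have lt: "i' < length ps" if "i' \<in> S" for i' using that S(2) by blast
    \<comment> \<open>At the prime of position \<open>i\<close> every other chosen cofactor
      vanishes, leaving a singleton support.\<close>
    have "\<not> int (ps ! i) dvd ?T ! i' \<longleftrightarrow> i' = i" if "i' \<in> S" for i'
      using nd[of "ps ! i" "ps ! i'"] lt[OF that] lt[OF i] ps by (auto simp: nth_eq_iff_index_eq)
    then have "{i'\<in>S. \<not> int (ps ! i) dvd ?T ! i'} = {i}" using i by blast
    moreover have "ps ! i \<in> prime_factors n" using lt[OF i] ps(1) Q(1) by auto
    moreover have "finite S" using S(2) finite_subset by blast
    ultimately show False using U_zero_sum_support[OF n sqf _ S(3,4)] by fastforce
  qed
  moreover have "set ?T \<subseteq> Zmod n"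
  proof -
    have "n div p < n" if "p \<in> Q" for p
      using n prime_gt_1_nat[OF pr(1)[OF that]] by (intro div_less_dividend) simp_all
    then have "int (n div p) < int n" if "p \<in> Q" for p using that by simp
    then show ?thesis using ps(1) by (auto simp: Zmod_eq simp del: zdiv_int of_nat_less_iff)
  qed
  ultimately show ?thesis using len by (intro exI[of _ ?T]) simp
qed

text \<open>By pigeonhole two terms coincide, and the weights 1 and \<open>n - 1\<close> cancel
  them. This shows that the minimum defining \<open>davenport\<close> is attained.\<close>

lemma U_forced:
  assumes "length T = n + 1" "set T \<subseteq> Zmod n"
  shows "has_wzs_subseq n (U n) T"
proof -
  have "\<not> distinct T"
  proof
    assume "distinct T"
    then have "card (set T) = n + 1" using assms(1) distinct_card by metis
    moreover have "card (set T) \<le> card (Zmod n)" using assms(2) by (intro card_mono) (auto simp: Zmod_eq)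
    ultimately show False by (simp add: Zmod_eq)
  qed
  then obtain i j where ij: "i < length T" "j < length T" "i \<noteq> j" "T ! i = T ! j"
    by (auto simp: distinct_conv_nth)
  have "coprime (int n - 1) (int n)" using coprime_diff_one_left by blast
  then have "1 \<in> U n" "int n - 1 \<in> U n" using n by (auto simp: U_eq[OF n])
  moreover have "(\<Sum>l\<in>{i, j}. (if l = i then 1 else int n - 1) * T ! l) = int n * T ! i"
    using ij by (simp add: algebra_simps)
  ultimately show ?thesis unfolding has_wzs_subseq_iff
    using ij by (intro exI[of _ "{i, j}"] exI[of _ "\<lambda>l. if l = i then 1 else int n - 1"]) auto
qed

text \<open>Lengths up to 4 force neither kind of subsequence, and longer lengths force both or
  neither, so the two minima are taken over the same set.\<close>

lemma davenport_L_eq_U: "davenport n (L n q) = davenport n (U n)" "davenport n (U n) \<ge> 5"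
proof -
  let ?f = "\<lambda>A k. k > 0 \<and> (\<forall>ys. length ys = k \<and> set ys \<subseteq> Zmod n \<longrightarrow> has_wzs_subseq n A ys)"
  have small: "\<not> ?f (U n) j" "\<not> ?f (L n q) j" if "j \<le> 4" for j
    using U_free_sequence[OF that] has_wzs_subseq_mono[OF L_subset_U] by blast+
  have "?f (L n q) j \<longleftrightarrow> ?f (U n) j" for j
  proof (cases "j \<le> 4")
    case False
    then show ?thesis using has_wzs_subseq_L_iff_U by auto
  qed (use small in blast)
  then show "davenport n (L n q) = davenport n (U n)" unfolding davenport_def by presburger
  have "?f (U n) (n + 1)" using U_forced by simp
  then have "?f (U n) (davenport n (U n))" unfolding davenport_def by (rule LeastI)
  then have "\<not> davenport n (U n) \<le> 4" using small(1) by blast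
  then show "davenport n (U n) \<ge> 5" by simp
qed

end

theorem theorem6p2:
  fixes n p' :: nat and T :: "int list"
  assumes "n > 0" and "squarefree n"
    and "\<forall>p. prime p \<and> p dvd n \<longrightarrow> p \<ge> 7"
    and "prime p'" and "p' dvd n"
    and "card (prime_factors n) \<noteq> 2" and "card (prime_factors n) \<noteq> 3"
    and "set T \<subseteq> Zmod n"
  shows "D_extremal n (L n p') T \<longleftrightarrow> D_extremal n (U n) T"
proof -
  have p': "p' \<in> prime_factors n" using assms(1,4,5) by (simp add: in_prime_factors_iff)
  have n: "n > 1"
    using assms(1) prime_gt_1_nat[OF assms(4)] dvd_imp_le[OF assms(5)] by linarith
  have "card (prime_factors n) \<noteq> 0" using p' by auto
  then consider "card (prime_factors n) = 1" | "card (prime_factors n) \<ge> 4"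
    using assms(6,7) by linarith
  then show ?thesis
  proof cases
    case 1
    then have "prime_factors n = {p'}" using p' by (auto simp: card_1_singleton_iff)
    then have "n = p'" using prod_prime_factors_eq[OF n assms(2)] by simp
    \<comment> \<open>For prime \<open>n\<close> the defining condition of \<open>L\<close> compares
      a symbol with itself.\<close>
    then show ?thesis by (simp add: L_def)
  next
    case 2
    have big: "\<forall>p\<in>prime_factors n. p \<ge> 7" using assms(3) by auto
    note dav = davenport_L_eq_U[OF n assms(2) big p' 2]
    \<comment> \<open>Extremal sequences are one shorter than the constant, so the bound 5 provides
      the four terms required.\<close>
    have "length T \<ge> 4" if "length T = davenport n (U n) - 1"
      using that dav(2) by simp
    then show ?thesis
      unfolding D_extremal_def dav(1)
      using has_wzs_subseq_L_iff_U[OF n assms(2) big p' 2, of T] by blast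
  qed
qed

end
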